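(* Let $\mathcal{A}=\{0,1\}$, let $n\ge 1$ be an integer, let $\mu$ be a shift-invariant probability measure on $X=\mathcal{A}^{\mathbb{Z}}$, and let $P(\mathbf{b})=\mu([\mathbf{b}]_i)$ for every block $\mathbf{b}$. For every $\mathbf{a}\in\mathcal{A}^{n-1}$ define $$\widehat{x}_{\mathbf{a}}=\begin{cases}\max\{0,\,P(0\mathbf{a})-P(\mathbf{a}1)\} & \text{if } |P(\mathbf{a}1)-P(0\mathbf{a})|<|P(\mathbf{a}0)-P(0\mathbf{a})|,\\ \min\{P(0\mathbf{a}),\,P(\mathbf{a}0)\} & \text{otherwise,}\end{cases}$$ and define $$\widehat{P}(0\mathbf{a}0)=\widehat{x}_{\mathbf{a}},\qquad \widehat{P}(0\mathbf{a}1)=P(0\mathbf{a})-\widehat{x}_{\mathbf{a}},$$ $$\widehat{P}(1\mathbf{a}0)=P(\mathbf{a}0)-\widehat{x}_{\mathbf{a}},\qquad \widehat{P}(1\mathbf{a}1)=P(\mathbf{a}1)-\bigl(P(0\mathbf{a})-\widehat{x}_{\mathbf{a}}\bigr),$$ so that $\widehat{P}(\mathbf{b})$ is defined for every $\mathbf{b}\in\mathcal{A}^{n+1}$. Then $$-\sum_{\mathbf{b}\in\mathcal{A}^{n+1}}\widehat{P}(\mathbf{b})\log\widehat{P}(\mathbf{b})\;\le\;-\sum_{\mathbf{b}\in\mathcal{A}^{n+1}}P(\mathbf{b})\log P(\mathbf{b}).$$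
   Context: A block of length $m$ is a finite word $\mathbf{b}=b_1b_2\ldots b_m$ over $\mathcal{A}$; $\mathcal{A}^m$ is the set of blocks of length $m$ ($\mathcal{A}^0$ contains only the empty block), and juxtaposition such as $0\mathbf{a}1$ denotes concatenation. For a block $\mathbf{b}$ of length $m$ and $i\in\mathbb{Z}$, the cylinder set is $[\mathbf{b}]_i=\{\mathbf{x}\in\mathcal{A}^{\mathbb{Z}}: x_i x_{i+1}\ldots x_{i+m-1}=\mathbf{b}\}$. Measures are on the $\sigma$-algebra generated by cylinder sets. By shift-invariance $P(\mathbf{b})=\mu([\mathbf{b}]_i)$ does not depend on $i$. The convention $0\log 0=0$ is used. *)

theory Defs
  imports "HOL-Probability.Probability" "HOL-Library.Z2"
begin

text \<open>
  The binary alphabet is the type \<open>bit\<close>, whose only elements are \<open>0\<close> and \<open>1\<close>. Blocks are lists and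
  bi-infinite sequences are functions on \<open>int\<close>.
\<close>

definition blocks :: "nat \<Rightarrow> 'a list set" where
  "blocks m = {b. length b = m}"

definition cylinder :: "'a list \<Rightarrow> int \<Rightarrow> (int \<Rightarrow> 'a) set" where
  "cylinder b i = {x. map (\<lambda>k. x (i + int k)) [0..<length b] = b}"

definition full_shift :: "(int \<Rightarrow> 'a) measure" where
  "full_shift = sigma UNIV {cylinder b i | b i. True}"

definition shift :: "(int \<Rightarrow> 'a) \<Rightarrow> int \<Rightarrow> 'a" where
  "shift x i = x (i + 1)"

definition shift_invariant :: "(int \<Rightarrow> 'a) measure \<Rightarrow> bool" where
  "shift_invariant M \<longleftrightarrow> (\<forall>A\<in>sets M. shift -` A \<in> sets M \<and> emeasure M (shift -` A) = emeasure M A)"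

text \<open>
  The position \<open>0\<close> is arbitrary for a shift-invariant measure, see \<open>block_prob_eq\<close> below.
\<close>

definition block_prob :: "(int \<Rightarrow> 'a) measure \<Rightarrow> 'a list \<Rightarrow> real" where
  "block_prob M b = measure M (cylinder b 0)"

definition x_hat :: "(bit list \<Rightarrow> real) \<Rightarrow> bit list \<Rightarrow> real" where
  "x_hat P a =
    (if \<bar>P (a @ [1]) - P (0 # a)\<bar> < \<bar>P (a @ [0]) - P (0 # a)\<bar>
     then max 0 (P (0 # a) - P (a @ [1]))
     else min (P (0 # a)) (P (a @ [0])))"

text \<open>
  A block of length at least two is decomposed as first letter, middle part and last letter;
  \<open>P_hat_simps\<close> below gives the resulting values on the four extensions of a block \<open>a\<close>.
\<close>

definition P_hat :: "(bit list \<Rightarrow> real) \<Rightarrow> bit list \<Rightarrow> real" where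
  "P_hat P b =
    (let a = butlast (tl b); x = x_hat P a in
     if hd b = 0
     then (if last b = 0 then x else P (0 # a) - x)
     else (if last b = 0 then P (a @ [0]) - x else P (a @ [1]) - (P (0 # a) - x)))"

text \<open>
  The base \<open>c\<close> of the logarithm is a parameter. Terms with \<open>Q b = 0\<close> vanish, which is the
  convention \<open>0 * log 0 = 0\<close>.
\<close>

definition block_entropy :: "real \<Rightarrow> nat \<Rightarrow> ('a list \<Rightarrow> real) \<Rightarrow> real" where
  "block_entropy c m Q = - (\<Sum>b\<in>blocks m. Q b * log c (Q b))"

lemma finite_blocks: "finite (blocks m :: bit list set)"
proof -
  have "finite (UNIV :: bit set)"
    by (rule finite_subset[of _ "{0, 1}"]) (auto intro: bit.exhaust)
  from finite_lists_length_eq[OF this, of m] show ?thesis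
    by (simp add: blocks_def)
qed

lemma space_full_shift [simp]: "space full_shift = UNIV"
  and cylinder_in_sets [measurable]: "cylinder b i \<in> sets full_shift"
  by (auto simp: full_shift_def)

lemma shift_vimage_cylinder: "shift -` cylinder b i = cylinder b (i + 1)"
  by (simp add: cylinder_def shift_def vimage_def ac_simps)

lemma block_prob_eq:
  assumes "sets M = sets full_shift" "shift_invariant M"
  shows "measure M (cylinder b i) = block_prob M b"
proof -
  have step: "measure M (cylinder b (j + 1)) = measure M (cylinder b j)" for j
    using assms unfolding shift_invariant_def measure_def
    by (metis cylinder_in_sets shift_vimage_cylinder)
  show ?thesis
    unfolding block_prob_def
  proof (induction i rule: int_induct[of _ 0])
    case (step2 j)
    then show ?case using step[of "j - 1"] by simp
  qed (simp_all add: step)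
qed

lemma P_hat_simps:
  "P_hat P (0 # a @ [0]) = x_hat P a"
  "P_hat P (0 # a @ [1]) = P (0 # a) - x_hat P a"
  "P_hat P (1 # a @ [0]) = P (a @ [0]) - x_hat P a"
  "P_hat P (1 # a @ [1]) = P (a @ [1]) - (P (0 # a) - x_hat P a)"
  by (simp_all add: P_hat_def Let_def)

end

theory Submission
  imports Defs
begin

text \<open>
  For fixed marginals, the four probabilities \<open>P (0 # a @ [0])\<close>, \<open>P (0 # a @ [1])\<close>,
  \<open>P (1 # a @ [0])\<close>, \<open>P (1 # a @ [1])\<close> are affine functions of the first one, \<open>x\<close>, which ranges
  over an interval. Their contribution to the entropy is a concave function of \<open>x\<close>, hence minimal at
  an endpoint. At the two endpoints, two of the four entries agree up to order and the other two have
  the same sum, so the endpoint with the smallest of these entries has the smaller entropy; the case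
  distinction in the definition of \<open>x_hat\<close> selects that endpoint.
\<close>

text \<open>On the open half-line the derivative of \<open>x * log c x\<close> is increasing. The
  endpoint 0, where this argument breaks down, has to be included because blocks may have
  probability 0.\<close>

lemma concave_on_neg_mult_log:
  fixes c :: real
  assumes "c > 1"
  shows "concave_on {0..} (\<lambda>x. - (x * log c x))"
  unfolding convex_on_iff_concave [symmetric]
proof (rule convex_on_linorderI)
  have pos: "convex_on {0<..} (\<lambda>x. x * log c x)"
  proof (rule convex_on_realI [where f' = "\<lambda>x. log c x + 1 / ln c"])
    show "((\<lambda>x. x * log c x) has_real_derivative log c x + 1 / ln c) (at x)"
      if "x \<in> {0<..}" for x
      using that assms by (auto simp: log_def add_divide_distrib intro!: derivative_eq_intros)
  qed (use assms in auto)
  fix t x y :: real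
  assume t: "t > 0" "t < 1" and xy: "x \<in> {0..}" "y \<in> {0..}" "x < y"
  show "((1 - t) *\<^sub>R x + t *\<^sub>R y) * log c ((1 - t) *\<^sub>R x + t *\<^sub>R y)
      \<le> (1 - t) * (x * log c x) + t * (y * log c y)"
  \<comment> \<open>As \<open>x < y\<close>, only \<open>x\<close> can be 0; its term then vanishes
    and monotonicity of the logarithm gives the chord inequality.\<close>
  proof (cases "x = 0")
    case True
    have "log c (t * y) \<le> log c y"
      using t xy assms True by simp
    then show ?thesis
      using t xy True by (simp add: mult_left_mono)
  next
    case False
    then show ?thesis
      using convex_onD [OF pos, of t x y] t xy by auto
  qed
qed simp

text \<open>The points \<open>u\<close> and \<open>v\<close> are convex combinations of
  \<open>m\<close> and \<open>M\<close> with the weights swapped, so adding the two concavity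
  inequalities cancels the weights.\<close>

lemma concave_on_spread:
  fixes f :: "real \<Rightarrow> real"
  assumes "concave_on S f" "m \<in> S" "M \<in> S" "m \<le> u" "m \<le> v" "u + v = m + M"
  shows "f m + f M \<le> f u + f v"
proof (cases "m = M")
  case True
  then show ?thesis using assms by (smt (verit))
next
  case False
  define t where "t = (u - m) / (M - m)"
  have t: "0 \<le> t" "t \<le> 1"
    using assms False by (auto simp: t_def field_split_simps)
  have tm: "t * (M - m) = u - m"
    using False by (simp add: t_def)
  have u: "u = (1 - t) *\<^sub>R m + t *\<^sub>R M" and v: "v = (1 - t) *\<^sub>R M + t *\<^sub>R m"
    using tm assms by (auto simp: algebra_simps)
  have "(1 - t) * f m + t * f M \<le> f u" "(1 - t) * f M + t * f m \<le> f v"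
    unfolding u v by (intro concave_onD [OF assms(1)] t assms(2,3))+
  then show ?thesis by (simp add: algebra_simps)
qed

text \<open>To be read with \<open>p\<close>, \<open>r\<close>, \<open>s\<close> as the
  probabilities of \<open>0 # a\<close>, \<open>a @ [0]\<close>, \<open>a @ [1]\<close> and
  \<open>x\<close> as that of \<open>0 # a @ [0]\<close>. The four conditions on \<open>x\<close>
  say that all cells are nonnegative.\<close>

lemma concave_on_extremal_cells:
  fixes f :: "real \<Rightarrow> real"
  defines "F \<equiv> \<lambda>p r s x. f x + f (p - x) + f (r - x) + f (s - (p - x))"
  assumes f: "concave_on {0..} f"
    and x: "0 \<le> x" "x \<le> p" "x \<le> r" "p - x \<le> s"
  shows "F p r s (if \<bar>s - p\<bar> < \<bar>r - p\<bar> then max 0 (p - s) else min p r) \<le> F p r s x"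
proof -
  define L R where "L = max 0 (p - s)" and "R = min p r"
  have L: "0 \<le> L" "L \<le> p" "L \<le> r" "p - L \<le> s" and R: "0 \<le> R" "R \<le> p" "R \<le> r" "p - R \<le> s"
    and LxR: "L \<le> x" "x \<le> R"
    using x by (auto simp: L_def R_def)
  obtain t where t: "0 \<le> t" "t \<le> 1" and xt: "x = (1 - t) * L + t * R"
  proof (cases "L = R")
    case True
    with LxR show ?thesis by (intro that [of 0]) auto
  next
    case False
    define t where "t = (x - L) / (R - L)"
    have "t * (R - L) = x - L"
      using False by (simp add: t_def)
    then have "x = (1 - t) * L + t * R"
      by (simp add: algebra_simps)
    moreover have "0 \<le> t" "t \<le> 1"
      using LxR False by (auto simp: t_def field_split_simps)
    ultimately show ?thesis
      using that by blast
  qed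
  \<comment> \<open>Each cell is affine in \<open>x\<close>, so the same weight \<open>t\<close>
    serves all four.\<close>
  have conv: "(1 - t) * f a + t * f b \<le> f y"
    if "0 \<le> a" "0 \<le> b" "y = (1 - t) * a + t * b" for a b y
    using concave_onD [OF f t, of a b] that by simp
  have "(1 - t) * f L + t * f R \<le> f x"
    "(1 - t) * f (p - L) + t * f (p - R) \<le> f (p - x)"
    "(1 - t) * f (r - L) + t * f (r - R) \<le> f (r - x)"
    "(1 - t) * f (s - (p - L)) + t * f (s - (p - R)) \<le> f (s - (p - x))"
    by (rule conv; use L R xt in \<open>simp add: algebra_simps\<close>)+
  then have mix: "(1 - t) * F p r s L + t * F p r s R \<le> F p r s x"
    by (simp add: F_def algebra_simps)
  have spread: "f m + f M \<le> f u + f v"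
    if "0 \<le> m" "m \<le> u" "m \<le> v" "u + v = m + M" for m u v M
    by (rule concave_on_spread [OF f]) (use that in auto)
  \<comment> \<open>The signs of \<open>s - p\<close> and \<open>r - p\<close> determine
    \<open>L\<close> and \<open>R\<close>. Once the two shared entries are cancelled,
    \<open>\<bar>s - p\<bar>\<close> remains at \<open>L\<close> and
    \<open>\<bar>r - p\<bar>\<close> at \<open>R\<close>; the lesser of them is the least remaining
    entry and serves as \<open>m\<close> in \<open>spread\<close>.\<close>
  have *: "if \<bar>s - p\<bar> < \<bar>r - p\<bar> then F p r s L \<le> F p r s R else F p r s R \<le> F p r s L"
  proof (cases "p \<le> s"; cases "p \<le> r")
    assume "p \<le> s" "p \<le> r"
    then show ?thesis using x spread [of "s - p" "r - p" s r] spread [of "r - p" "s - p" r s]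
      by (auto simp: F_def L_def R_def algebra_simps)
  next
    assume "p \<le> s" "\<not> p \<le> r"
    then show ?thesis using x
      spread [of "s - p" "p - r" "s - p + r" p] spread [of "p - r" p "s - p" "s - p + r"]
      by (auto simp: F_def L_def R_def algebra_simps)
  next
    assume "\<not> p \<le> s" "p \<le> r"
    then show ?thesis using x
      spread [of "p - s" p "r - p" "s - p + r"] spread [of "r - p" "p - s" "s - p + r" p]
      by (auto simp: F_def L_def R_def algebra_simps)
  next
    assume "\<not> p \<le> s" "\<not> p \<le> r"
    then show ?thesis using x spread [of "p - s" "p - r" r s] spread [of "p - r" "p - s" s r]
      by (auto simp: F_def L_def R_def algebra_simps)
  qed
  have "min (F p r s L) (F p r s R) = (1 - t) * min (F p r s L) (F p r s R) + t * min (F p r s L) (F p r s R)"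
    by (simp add: algebra_simps)
  also have "\<dots> \<le> (1 - t) * F p r s L + t * F p r s R"
    using t by (intro add_mono mult_left_mono) auto
  finally have "min (F p r s L) (F p r s R) \<le> F p r s x"
    using mix by simp
  with * show ?thesis
    unfolding L_def [symmetric] R_def [symmetric] by (auto split: if_splits)
qed

lemma sum_blocks_Cons:
  fixes f :: "bit list \<Rightarrow> 'b :: comm_monoid_add"
  shows "(\<Sum>b\<in>blocks (Suc m). f b) = (\<Sum>a\<in>blocks m. f (0 # a) + f (1 # a))"
proof -
  have split: "blocks (Suc m) = (#) (0 :: bit) ` blocks m \<union> (#) 1 ` blocks m"
    by (auto simp: blocks_def length_Suc_conv image_iff)
  have "(\<Sum>b\<in>blocks (Suc m). f b) = sum f ((#) 0 ` blocks m) + sum f ((#) 1 ` blocks m)"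
    unfolding split by (rule sum.union_disjoint) (auto simp: finite_blocks)
  then show ?thesis
    by (simp add: sum.reindex sum.distrib)
qed

text \<open>Reversal permutes the blocks of a given length and exchanges appending with
  prepending.\<close>

lemma sum_blocks_snoc:
  fixes f :: "bit list \<Rightarrow> 'b :: comm_monoid_add"
  shows "(\<Sum>b\<in>blocks (Suc m). f b) = (\<Sum>a\<in>blocks m. f (a @ [0]) + f (a @ [1]))"
proof -
  have rev: "(\<Sum>b\<in>blocks k. g (rev b)) = (\<Sum>b\<in>blocks k. g b)"
    for k and g :: "bit list \<Rightarrow> 'b"
    by (rule sum.reindex_bij_witness [where i = rev and j = rev]) (auto simp: blocks_def)
  show ?thesis
    using sum_blocks_Cons [of "\<lambda>b. f (rev b)" m]
    by (simp add: rev [of f] rev [of "\<lambda>a. f (a @ [0]) + f (a @ [1])"])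
qed

text \<open>Grouping by the middle block \<open>a\<close> isolates the four cells governed by a
  single value \<open>x_hat P a\<close>, so entropies can be compared for each \<open>a\<close>
  separately.\<close>

lemma block_entropy_Suc_Suc:
  fixes Q :: "bit list \<Rightarrow> real"
  defines "h \<equiv> \<lambda>c t. - (t * log c t)"
  shows "block_entropy c (Suc (Suc m)) Q =
    (\<Sum>a\<in>blocks m. h c (Q (0 # a @ [0])) + h c (Q (0 # a @ [1]))
      + h c (Q (1 # a @ [0])) + h c (Q (1 # a @ [1])))"
  unfolding block_entropy_def h_def sum_negf [symmetric]
  by (simp add: sum_blocks_Cons [of _ "Suc m"] sum_blocks_snoc [of _ m] algebra_simps)

lemma cylinder_snoc: "cylinder (b @ [z]) i = cylinder b i \<inter> {x. x (i + int (length b)) = z}"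
  by (auto simp: cylinder_def)

lemma cylinder_Cons: "cylinder (z # b) i = {x. x i = z} \<inter> cylinder b (i + 1)"
proof -
  have "[0..<length (z # b)] = 0 # map Suc [0..<length b]"
    by (simp add: upt_conv_Cons map_Suc_upt del: upt_Suc)
  then show ?thesis
    by (auto simp: cylinder_def o_def algebra_simps simp del: upt_Suc)
qed

text \<open>Both identities split a cylinder by one extra coordinate. Prepending a letter moves
  \<open>b\<close> to position 1, which is where shift invariance enters.\<close>

lemma block_prob_extend:
  fixes M :: "(int \<Rightarrow> bit) measure"
  assumes "prob_space M" and sets: "sets M = sets full_shift"
  shows block_prob_snoc: "block_prob M b = block_prob M (b @ [0]) + block_prob M (b @ [1])"
    and block_prob_Cons: "shift_invariant M \<Longrightarrow>
      block_prob M b = block_prob M (0 # b) + block_prob M (1 # b)"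
proof -
  interpret prob_space M by fact
  have add: "measure M A = measure M B + measure M C"
    if "B = cylinder b' i" "C = cylinder b'' j" "A = B \<union> C" "B \<inter> C = {}" for A B C b' b'' i j
    using that by (simp add: sets finite_measure_Union)
  show "block_prob M b = block_prob M (b @ [0]) + block_prob M (b @ [1])"
    unfolding block_prob_def by (rule add [OF refl refl]) (auto simp: cylinder_snoc)
  assume "shift_invariant M"
  then have "block_prob M b = measure M (cylinder b 1)"
    using block_prob_eq [OF sets] by metis
  also have "\<dots> = block_prob M (0 # b) + block_prob M (1 # b)"
    unfolding block_prob_def by (rule add [OF refl refl]) (auto simp: cylinder_Cons)
  finally show "block_prob M b = block_prob M (0 # b) + block_prob M (1 # b)" .
qed

theorem theorem2p1:
  fixes n :: nat and \<mu> :: "(int \<Rightarrow> bit) measure" and c :: real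
  assumes "n \<ge> 1"
    and "prob_space \<mu>"
    and "sets \<mu> = sets full_shift"
    and "shift_invariant \<mu>"
    and "c > 1"
  shows "block_entropy c (n + 1) (P_hat (block_prob \<mu>)) \<le> block_entropy c (n + 1) (block_prob \<mu>)"
proof -
  obtain m where n: "n + 1 = Suc (Suc m)"
    using assms(1) by (cases n) auto
  define P where "P = block_prob \<mu>"
  have nonneg: "0 \<le> P b" for b
    by (simp add: P_def block_prob_def)
  have snoc: "P b = P (b @ [0]) + P (b @ [1])" and Cons: "P b = P (0 # b) + P (1 # b)" for b
    unfolding P_def by (rule block_prob_snoc block_prob_Cons; fact)+
  define h where "h = (\<lambda>t. - (t * log c t))"
  have "h (P_hat P (0 # a @ [0])) + h (P_hat P (0 # a @ [1]))
      + h (P_hat P (1 # a @ [0])) + h (P_hat P (1 # a @ [1]))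
    \<le> h (P (0 # a @ [0])) + h (P (0 # a @ [1])) + h (P (1 # a @ [0])) + h (P (1 # a @ [1]))" for a
  proof -
    \<comment> \<open>This gives the cells of \<open>P\<close> the same form as those of
      \<open>P_hat P\<close>, with \<open>P (0 # a @ [0])\<close> in place of
      \<open>x_hat P a\<close>.\<close>
    have marg: "P (0 # a @ [1]) = P (0 # a) - P (0 # a @ [0])"
      "P (1 # a @ [0]) = P (a @ [0]) - P (0 # a @ [0])"
      "P (1 # a @ [1]) = P (a @ [1]) - (P (0 # a) - P (0 # a @ [0]))"
      using snoc [of "0 # a"] Cons [of "a @ [0]"] Cons [of "a @ [1]"] by simp_all
    have "concave_on {0..} h"
      unfolding h_def using assms(5) by (rule concave_on_neg_mult_log)
    then show ?thesis
      unfolding P_hat_simps x_hat_def marg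
      by (rule concave_on_extremal_cells)
        (use nonneg [of "0 # a @ [0]"] nonneg [of "0 # a @ [1]"] nonneg [of "1 # a @ [0]"]
          nonneg [of "1 # a @ [1]"] marg in auto)
  qed
  then show ?thesis
    unfolding n P_def h_def block_entropy_Suc_Suc by (rule sum_mono)
qed

end
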